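(* For every integer $k\ge 3$, the diameter of the graph $E(2.O_k)$ is $k$, and its girth is $4$.
   Context: For $k\ge 3$, let $\Omega=\{1,\dots,2k-1\}$. The extended graph $E(2.O_k)$ is the simple graph with vertex set $\{(v,i) : v\subset\Omega,\ |v|=k-1,\ i\in\{0,1\}\}$ in which $(v,i)$ and $(w,j)$ are adjacent if and only if $i\ne j$ and either $v\cap w=\emptyset$ or $v=w$. The diameter is the maximum distance between two vertices; the girth is the length of a shortest cycle. *)

theory Defs
  imports "Graph_Theory.Graph_Theory"
begin

text \<open>
  Simple graphs are represented, as in the Graph-Theory library, by loop-free symmetric
  digraphs without parallel arcs (\<^locale>\<open>pair_graph\<close>): each edge is a pair of opposite arcs.
\<close>

definition extended_graph :: "nat \<Rightarrow> (nat set \<times> nat) pair_pre_digraph" where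
  "extended_graph k =
    (let V = {(v, i). v \<subseteq> {1..2 * k - 1} \<and> card v = k - 1 \<and> i \<in> {0, 1}}
     in \<lparr> pverts = V,
          parcs = {((v, i), (w, j)). (v, i) \<in> V \<and> (w, j) \<in> V \<and>
                     i \<noteq> j \<and> (v \<inter> w = {} \<or> v = w)} \<rparr>)"

lemma extended_graph_pair_graph: "pair_graph (extended_graph k)"
proof -
  let ?E = "extended_graph k"
  have "pverts ?E \<subseteq> Pow {1..2 * k - 1} \<times> {0, 1}"
    by (auto simp: extended_graph_def Let_def)
  then have fin: "finite (pverts ?E)"
    by (rule finite_subset) simp
  have arcs_sub: "parcs ?E \<subseteq> pverts ?E \<times> pverts ?E"
    by (force simp: extended_graph_def Let_def)
  have fin_arcs: "finite (parcs ?E)"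
    using arcs_sub fin by (meson finite_SigmaI finite_subset)
  have no_loop: "(x, x) \<notin> parcs ?E" for x
    by (cases x) (simp add: extended_graph_def Let_def)
  have sym: "(y, x) \<in> parcs ?E" if "(x, y) \<in> parcs ?E" for x y
    using that by (cases x; cases y) (simp add: extended_graph_def Let_def Int_commute, metis)
  show ?thesis
  proof
    show "fst e \<in> pverts ?E" if "e \<in> parcs ?E" for e
      using subsetD[OF arcs_sub that] by (simp only: mem_Times_iff)
    show "snd e \<in> pverts ?E" if "e \<in> parcs ?E" for e
      using subsetD[OF arcs_sub that] by (simp only: mem_Times_iff)
    show "fst e \<noteq> snd e" if "e \<in> parcs ?E" for e
      using that no_loop by (metis prod.collapse)
    show "finite (pverts ?E)"
      by (rule fin)
    show "finite (parcs ?E)"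
      by (rule fin_arcs)
    show "symmetric (with_proj ?E)"
      unfolding symmetric_def arcs_ends_def arc_to_ends_def
      by (rule symI) (simp, erule sym)
  qed
qed

text \<open>
  With unit arc costs, the shortest-path cost \<^const>\<open>wf_digraph.\<mu>\<close> is the distance in number of
  edges, infinite between different components.
\<close>

definition graph_dist :: "('a, 'b) pre_digraph \<Rightarrow> 'a \<Rightarrow> 'a \<Rightarrow> ereal" where
  "graph_dist G u v = wf_digraph.\<mu> G (\<lambda>_. 1) u v"

definition graph_diameter :: "('a, 'b) pre_digraph \<Rightarrow> ereal" where
  "graph_diameter G = (SUP (u, v) \<in> verts G \<times> verts G. graph_dist G u v)"

lemma graph_diameter_eq_Max:
  assumes "finite (verts G)" "verts G \<noteq> {}"
  shows "graph_diameter G = Max ((\<lambda>(u, v). graph_dist G u v) ` (verts G \<times> verts G))"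
  unfolding graph_diameter_def using assms by (intro Max_Sup[symmetric]) auto

text \<open>
  The predicate \<^const>\<open>pre_digraph.cycle\<close> also holds for traversing one edge back and forth, which
  is not a cycle of the undirected graph; hence the bound on the length. The girth of an acyclic
  graph is \<open>\<infinity>\<close>.
\<close>

definition graph_girth :: "('a, 'b) pre_digraph \<Rightarrow> enat" where
  "graph_girth G = (INF p \<in> {p. pre_digraph.cycle G p \<and> 3 \<le> length p}. enat (length p))"

end

theory Submission
  imports Defs
begin

text \<open>
  Write \<open>d = |v - w|\<close> for vertices \<open>(v, i)\<close> and \<open>(w, j)\<close>; then \<open>|v \<inter> w| = k - 1 - d\<close>. Two
  consecutive disjointness edges can exchange a single element of a set, so there is a walk with
  \<open>2d\<close> edges from \<open>(v, i)\<close> to \<open>(w, i)\<close> (\<open>relpow_same_side\<close>). Replacing \<open>v\<close> first by a set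
  disjoint from it that contains \<open>w - v\<close> gives a walk with \<open>2 |v \<inter> w| + 1 = 2k - 2d - 1\<close> edges to
  the other copy of \<open>w\<close> (\<open>relpow_opposite_side\<close>). An edge between the two copies of a set turns
  each kind of walk into one for the other parity, at the price of one edge. Hence any two vertices
  are joined by two walks, with \<open>2d\<close> and \<open>2k - 2d\<close> edges if \<open>i = j\<close>, and with \<open>2d + 1\<close> and
  \<open>2k - 2d - 1\<close> edges otherwise. In both cases the lengths add up to \<open>2k\<close>, so one of them is at
  most \<open>k\<close>.

  These walks are optimal: the smaller of the two lengths, as a function of \<open>(w, j)\<close>, changes by at
  most one along each edge (\<open>potential_step\<close>). The reason is that two disjoint sets \<open>w, w'\<close> miss
  only one point of \<open>{1..2k - 1}\<close>, whence \<open>|v - w| + |v - w'|\<close> is \<open>k - 1\<close> or \<open>k\<close>. Both lengths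
  equal \<open>k\<close> when \<open>d = k div 2\<close> and the difference of the indices is \<open>k mod 2\<close>, so the diameter
  is exactly \<open>k\<close>.

  For the girth, every edge changes the index, so the graph is bipartite and has no triangles,
  while two disjoint sets together with their copies span a cycle with four edges.
\<close>

section \<open>Walks, distances and potentials\<close>

lemma (in wf_digraph) awalk_cost_one: "awalk_cost (\<lambda>_. 1) p = real (length p)"
  by (induction p) simp_all

lemma (in wf_digraph) graph_dist_le_length:
  assumes "awalk u p v"
  shows "graph_dist G u v \<le> ereal (real (length p))"
  using min_cost_le_walk_cost[OF assms, of "\<lambda>_. 1"]
  by (simp add: graph_dist_def awalk_cost_one)

lemma (in wf_digraph) graph_dist_geI:
  assumes "\<And>p. awalk u p v \<Longrightarrow> n \<le> length p"
  shows "ereal (real n) \<le> graph_dist G u v"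
  unfolding graph_dist_def \<mu>_def
  by (intro INF_greatest) (use assms in \<open>auto simp: awalk_cost_one\<close>)

text \<open>
  A function on the vertices that grows by at most one along each arc bounds distances from below.
\<close>

lemma (in wf_digraph) potential_le_length:
  fixes f :: "'a \<Rightarrow> nat"
  assumes "\<And>e. e \<in> arcs G \<Longrightarrow> f (head G e) \<le> f (tail G e) + 1"
    and "awalk u p v"
  shows "f v \<le> f u + length p"
  using assms(2)
proof (induction p arbitrary: u)
  case Nil
  then show ?case by (simp add: awalk_Nil_iff)
next
  case (Cons e p)
  then have "e \<in> arcs G" "u = tail G e" "f v \<le> f (head G e) + length p"
    by (auto simp: awalk_Cons_iff)
  with assms(1)[of e] show ?case by simp
qed

text \<open>
  Powers of the arc relation carry the upper bounds, since they compose without explicit arc lists.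
\<close>

lemma (in pair_wf_digraph) graph_dist_le_relpow:
  assumes "u \<in> pverts G" "(u, v) \<in> parcs G ^^ n"
  shows "graph_dist (with_proj G) u v \<le> ereal (real n)"
proof -
  have "\<exists>p. awalk u p v \<and> length p = n"
    using assms
  proof (induction n arbitrary: u)
    case 0
    then show ?case by (simp add: awalk_Nil_iff)
  next
    case (Suc n)
    then obtain x where x: "(u, x) \<in> parcs G" "(x, v) \<in> parcs G ^^ n"
      by (meson relpow_Suc_D2)
    with Suc.IH[of x] obtain p where "awalk x p v" "length p = n"
      using arc_snd_in_verts[of "(u, x)"] by auto
    with x show ?case
      by (intro exI[of _ "(u, x) # p"]) (simp add: awalk_Cons_iff)
  qed
  then show ?thesis using graph_dist_le_length by auto
qed

section \<open>Moving between subsets\<close>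

text \<open>
  These sets are the vertices of the odd graph \<open>O\<^sub>k\<close>, whose edges join disjoint sets; the extended
  graph has two copies of each.
\<close>

definition layer :: "nat \<Rightarrow> nat set set" where
  "layer k = {v. v \<subseteq> {1..2 * k - 1} \<and> card v = k - 1}"

lemma finite_layer: "v \<in> layer k \<Longrightarrow> finite v"
  by (auto simp: layer_def intro: finite_subset)

lemma card_layer: "v \<in> layer k \<Longrightarrow> card v = k - 1"
  by (simp add: layer_def)

lemma pverts_extended_graph [simp]:
  "(v, i) \<in> pverts (extended_graph k) \<longleftrightarrow> v \<in> layer k \<and> i \<in> {0, 1}"
  by (auto simp: extended_graph_def layer_def Let_def)

lemma parcs_extended_graph [simp]:
  "((v, i), (w, j)) \<in> parcs (extended_graph k) \<longleftrightarrow>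
    v \<in> layer k \<and> w \<in> layer k \<and> i \<in> {0, 1} \<and> j \<in> {0, 1} \<and> i \<noteq> j \<and> (v \<inter> w = {} \<or> v = w)"
  by (auto simp: extended_graph_def layer_def Let_def)

lemma card_Diff_layer:
  assumes "v \<in> layer k" "w \<in> layer k"
  shows "card (v - w) + card (v \<inter> w) = k - 1"
  using card_Diff_subset_Int[of v w] finite_layer[OF assms(1)] card_layer[OF assms(1)]
    card_mono[of v "v \<inter> w"] by simp

lemma card_Diff_commute_layer:
  assumes "v \<in> layer k" "w \<in> layer k"
  shows "card (w - v) = card (v - w)"
  using card_Diff_layer[OF assms] card_Diff_layer[OF assms(2,1)] by (simp add: Int_commute)

text \<open>
  If \<open>a \<in> v - w\<close> and \<open>b \<in> w - v\<close>, the complement of \<open>v \<union> {b}\<close> has \<open>k - 1\<close> elements and is disjoint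
  both from \<open>v\<close> and from \<open>(v - {a}) \<union> {b}\<close>, which is closer to \<open>w\<close> by one element. So each
  exchange costs two edges.
\<close>

lemma relpow_same_side:
  assumes "v \<in> layer k" "w \<in> layer k" "i \<in> {0, 1}" "k \<ge> 1"
  shows "((v, i), (w, i)) \<in> parcs (extended_graph k) ^^ (2 * card (v - w))"
  using assms(1)
proof (induction "card (v - w)" arbitrary: v)
  case 0
  then have "v \<subseteq> w" using finite_layer[of v k] by simp
  with 0 have "v = w"
    using assms(2) by (simp add: card_subset_eq finite_layer card_layer)
  then show ?case by simp
next
  case (Suc n)
  have fin: "finite v" "finite w" using Suc.prems assms(2) finite_layer by auto
  from Suc.hyps(2) obtain a where a: "a \<in> v - w" by (metis card.empty equals0I nat.distinct(1))
  have "card (w - v) \<noteq> 0"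
    using card_Diff_commute_layer[OF Suc.prems assms(2)] Suc.hyps(2) by simp
  then obtain b where b: "b \<in> w - v" by (metis card.empty equals0I)
  define v' where "v' = insert b (v - {a})"
  define x where "x = {1..2 * k - 1} - insert b v"
  have bv: "insert b v \<subseteq> {1..2 * k - 1}"
    using b Suc.prems assms(2) by (auto simp: layer_def)
  have "card (insert b v) = k"
    using b fin card_layer[OF Suc.prems] assms(4) by simp
  then have x: "x \<in> layer k"
    using bv fin by (auto simp: x_def layer_def card_Diff_subset)
  have "card v' = card v"
    using a b card_Suc_Diff1[OF fin(1), of a] by (simp add: v'_def fin)
  then have v': "v' \<in> layer k"
    using bv Suc.prems by (auto simp: layer_def v'_def)
  have "v' - w = (v - w) - {a}" using b by (auto simp: v'_def)
  then have n: "n = card (v' - w)" using Suc.hyps(2) a fin by simp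
  have "((v, i), (x, 1 - i)) \<in> parcs (extended_graph k)"
    "((x, 1 - i), (v', i)) \<in> parcs (extended_graph k)"
    using Suc.prems x v' assms(3) by (auto simp: x_def v'_def)
  with Suc.hyps(1)[OF n v'] have
    "((v, i), (w, i)) \<in> parcs (extended_graph k) ^^ Suc (Suc (2 * n))"
    using n by (metis relpow_Suc_I2)
  moreover have "2 * card (v - w) = Suc (Suc (2 * n))" using Suc.hyps(2) by linarith
  ultimately show ?case by (simp only:)
qed

text \<open>
  The first edge leads to a set \<open>u\<close> disjoint from \<open>v\<close> that is as close to \<open>w\<close> as possible: it contains
  all of \<open>w - v\<close>, so that \<open>|u - w| = |v \<inter> w|\<close> exchanges remain.
\<close>

lemma relpow_opposite_side:
  assumes "v \<in> layer k" "w \<in> layer k" "i \<in> {0, 1}" "k \<ge> 1"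
  shows "((v, i), (w, 1 - i)) \<in> parcs (extended_graph k) ^^ (2 * card (v \<inter> w) + 1)"
proof -
  have fin: "finite v" "finite w" using assms finite_layer by auto
  have v: "v \<subseteq> {1..2 * k - 1}" using assms by (simp add: layer_def)
  have "card ({1..2 * k - 1} - v) = k"
    using v fin card_layer[OF assms(1)] assms(4) by (simp add: card_Diff_subset)
  moreover have "card (w - v) \<le> k - 1"
    using card_layer[OF assms(2)] card_mono[of w "w - v"] fin by auto
  ultimately obtain u where u: "w - v \<subseteq> u" "u \<subseteq> {1..2 * k - 1} - v" "card u = k - 1"
    using exists_subset_between[of "w - v" "k - 1" "{1..2 * k - 1} - v"] assms(2)
    by (auto simp: layer_def)
  then have ul: "u \<in> layer k" by (auto simp: layer_def)
  have "u \<inter> w = w - v" using u by auto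
  then have "card (u - w) = card (v \<inter> w)"
    using card_Diff_layer[OF ul assms(2)] card_Diff_layer[OF assms(2,1)]
    by (simp add: Int_commute)
  moreover have "((v, i), (u, 1 - i)) \<in> parcs (extended_graph k)"
    using assms ul u by auto
  moreover have "((u, 1 - i), (w, 1 - i)) \<in> parcs (extended_graph k) ^^ (2 * card (u - w))"
    using relpow_same_side[OF ul assms(2) _ assms(4), of "1 - i"] assms(3) by auto
  ultimately show ?thesis by (metis Suc_eq_plus1 relpow_Suc_I2)
qed

section \<open>The diameter\<close>

lemma extended_graph_dist_le:
  assumes "x \<in> pverts (extended_graph k)" "y \<in> pverts (extended_graph k)" "k \<ge> 1"
  shows "graph_dist (with_proj (extended_graph k)) x y \<le> ereal (real k)"
proof -
  interpret pair_graph "extended_graph k" by (rule extended_graph_pair_graph)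
  obtain v i w j where xy: "x = (v, i)" "y = (w, j)" by fastforce
  with assms have v: "v \<in> layer k" and w: "w \<in> layer k" and ij: "i \<in> {0, 1}" "j \<in> {0, 1}"
    by auto
  note sum = card_Diff_layer[OF v w]
  have flip: "((v, i), (v, 1 - i)) \<in> parcs (extended_graph k)"
    using v ij by auto
  have "\<exists>n\<le>k. (x, y) \<in> parcs (extended_graph k) ^^ n"
  proof (cases "i = j")
    case True
    have "((v, 1 - i), (w, 1 - (1 - i))) \<in>
        parcs (extended_graph k) ^^ (2 * card (v \<inter> w) + 1)"
      using ij by (intro relpow_opposite_side[OF v w _ assms(3)]) auto
    moreover have "1 - (1 - i) = i" using ij by auto
    ultimately have "(x, y) \<in> parcs (extended_graph k) ^^ (Suc (2 * card (v \<inter> w) + 1))"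
      using relpow_Suc_I2[OF flip] xy True by metis
    moreover have "(x, y) \<in> parcs (extended_graph k) ^^ (2 * card (v - w))"
      using relpow_same_side[OF v w ij(1) assms(3)] xy True by simp
    moreover have "2 * card (v - w) \<le> k \<or> Suc (2 * card (v \<inter> w) + 1) \<le> k"
      using sum assms(3) by linarith
    ultimately show ?thesis by blast
  next
    case False
    then have j: "j = 1 - i" using ij by auto
    have "(x, y) \<in> parcs (extended_graph k) ^^ (2 * card (v \<inter> w) + 1)"
      using relpow_opposite_side[OF v w ij(1) assms(3)] xy j by simp
    moreover have "(x, y) \<in> parcs (extended_graph k) ^^ (Suc (2 * card (v - w)))"
      using relpow_Suc_I2[OF flip] relpow_same_side[OF v w ij(2) assms(3)] xy j by simp
    moreover have "2 * card (v \<inter> w) + 1 \<le> k \<or> Suc (2 * card (v - w)) \<le> k"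
      using sum assms(3) by linarith
    ultimately show ?thesis by blast
  qed
  then obtain n where "n \<le> k" "(x, y) \<in> parcs (extended_graph k) ^^ n" by blast
  with graph_dist_le_relpow[OF assms(1)] have
    "graph_dist (with_proj (extended_graph k)) x y \<le> ereal (real n)" by blast
  also have "\<dots> \<le> ereal (real k)" using \<open>n \<le> k\<close> by simp
  finally show ?thesis .
qed

text \<open>
  The distance from \<open>(v, 0)\<close>, as a formula: the smaller of the lengths of the two walks constructed
  above.
\<close>

definition potential :: "nat \<Rightarrow> nat set \<Rightarrow> nat set \<times> nat \<Rightarrow> nat" where
  "potential k v = (\<lambda>(w, j). let d = 2 * card (v - w) + j
     in min d (2 * k - d))"

text \<open>
  For \<open>k > 0\<close> the sets \<open>w\<close> and \<open>w'\<close> cover all but one point of \<open>{1..2k - 1}\<close>, so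
  \<open>|v \<inter> w| + |v \<inter> w'|\<close> differs from \<open>|v|\<close> by at most one.
\<close>

lemma card_Diff_disjoint:
  assumes "v \<in> layer k" "w \<in> layer k" "w' \<in> layer k" "w \<inter> w' = {}"
  shows "card (v - w) + card (v - w') \<in> {k - 1, k}"
proof (cases "k = 0")
  case True
  then show ?thesis
    using card_Diff_layer[OF assms(1,2)] card_Diff_layer[OF assms(1,3)] by simp
next
  case False
  have fin: "finite v" "finite w" "finite w'" using assms finite_layer by auto
  have "card (w \<union> w') = 2 * (k - 1)"
    using card_Un_disjoint[OF fin(2,3) assms(4)] assms card_layer by simp
  then have "card ({1..2 * k - 1} - (w \<union> w')) = 1"
    using assms fin False by (subst card_Diff_subset) (auto simp: layer_def)
  moreover have "card (v - (w \<union> w')) \<le> card ({1..2 * k - 1} - (w \<union> w'))"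
    using assms by (intro card_mono) (auto simp: layer_def)
  moreover have "card v = card (v - (w \<union> w')) + (card (v \<inter> w) + card (v \<inter> w'))"
  proof -
    have "v = (v - (w \<union> w')) \<union> ((v \<inter> w) \<union> (v \<inter> w'))" by auto
    also have "card \<dots> = card (v - (w \<union> w')) + card ((v \<inter> w) \<union> (v \<inter> w'))"
      using fin by (intro card_Un_disjoint) auto
    also have "card ((v \<inter> w) \<union> (v \<inter> w')) = card (v \<inter> w) + card (v \<inter> w')"
      using fin assms(4) by (intro card_Un_disjoint) auto
    finally show ?thesis .
  qed
  ultimately show ?thesis
    using card_Diff_layer[OF assms(1,2)] card_Diff_layer[OF assms(1,3)] card_layer[OF assms(1)]
      False
    by (simp; linarith)
qed

text \<open>
  An edge \<open>w = w'\<close> changes \<open>2 |v - w| + j\<close> by one. A disjointness edge replaces it, up to an error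
  of one, by its difference from \<open>2k\<close>, which swaps the two arguments of the minimum.
\<close>

lemma potential_step:
  assumes "(x, y) \<in> parcs (extended_graph k)" "v \<in> layer k" "k \<ge> 1"
  shows "potential k v y \<le> potential k v x + 1"
proof -
  obtain w i w' i' where xy: "x = (w, i)" "y = (w', i')" by fastforce
  with assms(1) have w: "w \<in> layer k" "w' \<in> layer k" and i: "i \<in> {0, 1}" "i' \<in> {0, 1}" "i \<noteq> i'"
    and adj: "w \<inter> w' = {} \<or> w = w'" by auto
  have le: "card (v - w) \<le> k - 1" "card (v - w') \<le> k - 1"
    using card_Diff_layer[OF assms(2) w(1)] card_Diff_layer[OF assms(2) w(2)] by linarith+
  have "card (v - w) + card (v - w') + 1 = k \<or> card (v - w) + card (v - w') = k \<or>
      card (v - w) = card (v - w')"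
    using adj card_Diff_disjoint[OF assms(2) w] assms(3) by auto
  moreover have "i = 0 \<and> i' = 1 \<or> i = 1 \<and> i' = 0"
    using i by auto
  moreover define d d' where "d = 2 * card (v - w) + i" and "d' = 2 * card (v - w') + i'"
  ultimately have "d' = d + 1 \<or> d = d' + 1 \<or> d + d' + 1 = 2 * k \<or> d + d' = 2 * k + 1"
    by (elim disjE conjE) linarith+
  moreover have "d < 2 * k" "d' < 2 * k"
    using le i assms(3) by (auto simp: d_def d'_def)
  ultimately have "min d' (2 * k - d') \<le> min d (2 * k - d) + 1"
    by (elim disjE) (auto simp: min_def)
  then show ?thesis
    by (simp add: potential_def xy d_def d'_def Let_def)
qed

text \<open>
  The two walk lengths add up to \<open>2k\<close>, so the distance is largest where they agree: the target is the
  shift of \<open>v\<close> by \<open>k div 2\<close>, and its index \<open>k mod 2\<close> makes \<open>2 |v - w| + j\<close> equal to \<open>k\<close> for both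
  parities of \<open>k\<close>.
\<close>

lemma extended_graph_dist_attained:
  assumes "k \<ge> 1"
  shows "\<exists>x\<in>pverts (extended_graph k). \<exists>y\<in>pverts (extended_graph k).
    ereal (real k) \<le> graph_dist (with_proj (extended_graph k)) x y"
proof -
  interpret pair_graph "extended_graph k" by (rule extended_graph_pair_graph)
  define m where "m = k div 2"
  define v where "v = {1..k - 1}"
  define w where "w = {m + 1..m + (k - 1)}"
  have v: "v \<in> layer k" and w: "w \<in> layer k"
    using assms by (auto simp: layer_def v_def w_def m_def)
  have "v - w = {1..m}"
    using assms by (auto simp: v_def w_def m_def)
  then have "potential k v (w, k mod 2) = k"
    by (simp add: potential_def m_def)
  moreover have "potential k v (v, 0) = 0" by (simp add: potential_def)
  ultimately have "ereal (real k) \<le> graph_dist (with_proj (extended_graph k)) (v, 0) (w, k mod 2)"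
    using potential_le_length[of "potential k v" "(v, 0)" _ "(w, k mod 2)",
        OF potential_step[OF _ v assms]]
    by (intro graph_dist_geI) simp
  moreover have "(v, 0) \<in> pverts (extended_graph k)" "(w, k mod 2) \<in> pverts (extended_graph k)"
    using v w by auto
  ultimately show ?thesis by blast
qed

lemma graph_diameter_extended_graph:
  assumes "k \<ge> 1"
  shows "graph_diameter (with_proj (extended_graph k)) = ereal (real k)"
  unfolding graph_diameter_def
proof (rule antisym)
  show "(SUP (u, v)\<in>verts (with_proj (extended_graph k)) \<times> verts (with_proj (extended_graph k)).
      graph_dist (with_proj (extended_graph k)) u v) \<le> ereal (real k)"
    using extended_graph_dist_le[OF _ _ assms] by (intro SUP_least) auto
  show "ereal (real k) \<le>
      (SUP (u, v)\<in>verts (with_proj (extended_graph k)) \<times> verts (with_proj (extended_graph k)).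
        graph_dist (with_proj (extended_graph k)) u v)"
    using extended_graph_dist_attained[OF assms]
    by (auto intro: SUP_upper2[where i = "(a, b)" for a b])
qed

section \<open>The girth\<close>

lemma extended_graph_awalk_parity:
  assumes "pre_digraph.awalk (with_proj (extended_graph k)) x p y"
  shows "even (length p) \<longleftrightarrow> snd x = snd y"
proof -
  interpret pair_graph "extended_graph k" by (rule extended_graph_pair_graph)
  \<comment> \<open>Flipping the index twice restores it only because the indices are confined to two values.\<close>
  have "(even (length p) \<longleftrightarrow> snd x = snd y) \<and> snd x \<in> {0, 1} \<and> snd y \<in> {0, 1}"
    using assms
  proof (induction p arbitrary: x)
    case Nil
    then show ?case by (cases x) (auto simp: awalk_Nil_iff)
  next
    case (Cons e p)
    obtain w i w' i' where e: "e = ((w, i), (w', i'))" by (metis prod.collapse)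
    with Cons show ?case by (force simp: awalk_Cons_iff)
  qed
  then show ?thesis by blast
qed

lemma extended_graph_four_cycle:
  assumes "v \<in> layer k" "w \<in> layer k" "v \<inter> w = {}" "v \<noteq> w"
  shows "pre_digraph.cycle (with_proj (extended_graph k))
    [((v, 0), (w, 1)), ((w, 1), (w, 0)), ((w, 0), (v, 1)), ((v, 1), (v, 0))]"
proof -
  interpret pair_graph "extended_graph k" by (rule extended_graph_pair_graph)
  show ?thesis
    unfolding cycle_def using assms by (auto simp: awalk_simps)
qed

lemma graph_girth_extended_graph:
  assumes "k \<ge> 2"
  shows "graph_girth (with_proj (extended_graph k)) = 4"
proof (rule antisym)
  interpret pair_graph "extended_graph k" by (rule extended_graph_pair_graph)
  define v w where "v = {1..k - 1}" and "w = {k..2 * k - 2}"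
  have "v \<in> layer k" "w \<in> layer k" "v \<inter> w = {}" "v \<noteq> w"
    using assms by (auto simp: v_def w_def layer_def)
  from extended_graph_four_cycle[OF this]
  show "graph_girth (with_proj (extended_graph k)) \<le> 4"
    unfolding graph_girth_def by (intro INF_lower2) (auto simp: numeral_eq_enat)
  have "4 \<le> length p" if "cycle p" "3 \<le> length p" for p
  proof -
    from that(1) obtain x where "awalk x p x" by (auto simp: cycle_def)
    then have "even (length p)" using extended_graph_awalk_parity by blast
    with that(2) show ?thesis by (cases "length p = 3") auto
  qed
  then show "4 \<le> graph_girth (with_proj (extended_graph k))"
    unfolding graph_girth_def by (intro INF_greatest) (simp add: numeral_eq_enat)
qed

theorem proposition3p2:
  fixes k :: nat
  assumes "k \<ge> 3"
  shows "graph_diameter (with_proj (extended_graph k)) = ereal (real k) \<and>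
         graph_girth (with_proj (extended_graph k)) = 4"
  using assms by (simp add: graph_diameter_extended_graph graph_girth_extended_graph)

end
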